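(* Let $D_8$ be the dihedral group of order $8$. Then the finite group $G=D_8\times D_8$ satisfies $|\operatorname{Cent}(G)|=\left|\frac{G}{Z(G)}\right|=16$, but $G$ is not an F-group. In particular, it is not true that every finite group $G$ with $|\operatorname{Cent}(G)|=\left|\frac{G}{Z(G)}\right|$ is an F-group.
   Context: For a group $G$, $Z(G)$ is its center, $C(x)$ is the centralizer in $G$ of $x\in G$, and $\operatorname{Cent}(G)=\{C(x)\mid x\in G\}$ is the set of element centralizers of $G$ (including $G$ itself). A finite group $G$ is an F-group if for every $x,y\in G\setminus Z(G)$, $C(x)\le C(y)$ implies $C(x)=C(y)$. *)

theory Defs
  imports "HOL-Algebra.Algebra"
begin

definition centralizer :: "('a, 'b) monoid_scheme \<Rightarrow> 'a \<Rightarrow> 'a set"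
  where "centralizer G x = {g \<in> carrier G. g \<otimes>\<^bsub>G\<^esub> x = x \<otimes>\<^bsub>G\<^esub> g}"

definition center :: "('a, 'b) monoid_scheme \<Rightarrow> 'a set"
  where "center G = {z \<in> carrier G. \<forall>g \<in> carrier G. g \<otimes>\<^bsub>G\<^esub> z = z \<otimes>\<^bsub>G\<^esub> g}"

definition Cent :: "('a, 'b) monoid_scheme \<Rightarrow> 'a set set"
  where "Cent G = {centralizer G x | x. x \<in> carrier G}"

text \<open>Meant for finite groups only: that \<open>G\<close> is a finite group is not part of the predicate,
  so that its negation is never due to a failure of that side condition.\<close>

definition F_group :: "('a, 'b) monoid_scheme \<Rightarrow> bool"
  where "F_group G \<longleftrightarrow>
    (\<forall>x \<in> carrier G - center G. \<forall>y \<in> carrier G - center G.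
       centralizer G x \<subseteq> centralizer G y \<longrightarrow> centralizer G x = centralizer G y)"

text \<open>The dihedral group of order \<open>2 * n\<close> (for \<open>n > 0\<close>): the pair \<open>(i, b)\<close> stands for
  \<open>r\<^sup>i s\<^sup>b\<close>, where \<open>r\<close> is the rotation, of order \<open>n\<close>, and \<open>s\<close> is a reflection,
  so that \<open>s r\<^sup>j = r\<^sup>-\<^sup>j s\<close>.\<close>

definition dihedral_group :: "nat \<Rightarrow> (int \<times> bool) monoid"
  where "dihedral_group n =
    \<lparr>carrier = {0..<int n} \<times> UNIV,
     monoid.mult = (\<lambda>(i, b) (j, c). ((if b then i - j else i + j) mod int n, b \<noteq> c)),
     one = (0, False)\<rparr>"

abbreviation D8 :: "(int \<times> bool) monoid"
  where "D8 \<equiv> dihedral_group 4"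

lemma group_dihedral_group:
  assumes "n > 0"
  shows "group (dihedral_group n)"
proof (rule groupI)
  fix x assume "x \<in> carrier (dihedral_group n)"
  then obtain i b where x: "x = (i, b)" "0 \<le> i" "i < int n"
    by (auto simp: dihedral_group_def)
  show "\<exists>y\<in>carrier (dihedral_group n).
          y \<otimes>\<^bsub>dihedral_group n\<^esub> x = \<one>\<^bsub>dihedral_group n\<^esub>"
    using x assms
    by (intro bexI[of _ "(if b then i else (- i) mod int n, b)"])
       (auto simp: dihedral_group_def mod_simps)
qed (use assms in \<open>auto simp: dihedral_group_def mod_simps algebra_simps\<close>)

lemma order_dihedral_group: "order (dihedral_group n) = 2 * n"
  by (simp add: order_def dihedral_group_def card_cartesian_product)

lemma dihedral_group_relations:
  assumes "n > 1"
  defines "r \<equiv> (1, False)" and "s \<equiv> (0, True)"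
  shows "r [^]\<^bsub>dihedral_group n\<^esub> n = \<one>\<^bsub>dihedral_group n\<^esub>"
    and "s \<otimes>\<^bsub>dihedral_group n\<^esub> s = \<one>\<^bsub>dihedral_group n\<^esub>"
    and "s \<otimes>\<^bsub>dihedral_group n\<^esub> r \<otimes>\<^bsub>dihedral_group n\<^esub> s = inv\<^bsub>dihedral_group n\<^esub> r"
proof -
  interpret group "dihedral_group n"
    using assms(1) by (intro group_dihedral_group) simp
  have "r [^]\<^bsub>dihedral_group n\<^esub> (k::nat) = (int k mod int n, False)" for k
    by (induction k) (auto simp: nat_pow_def dihedral_group_def r_def mod_simps algebra_simps)
  then show "r [^]\<^bsub>dihedral_group n\<^esub> n = \<one>\<^bsub>dihedral_group n\<^esub>"
    by (simp add: dihedral_group_def)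
  show "s \<otimes>\<^bsub>dihedral_group n\<^esub> s = \<one>\<^bsub>dihedral_group n\<^esub>"
    by (simp add: dihedral_group_def s_def)
  show "s \<otimes>\<^bsub>dihedral_group n\<^esub> r \<otimes>\<^bsub>dihedral_group n\<^esub> s = inv\<^bsub>dihedral_group n\<^esub> r"
    using assms(1)
    by (intro inv_equality[symmetric])
       (auto simp: dihedral_group_def r_def s_def mod_simps)
qed

end

theory Submission
  imports Defs
begin

text \<open>
  Centralizers and centers of a direct product are products of those of the factors, so both
  \<^term>\<open>card (Cent G)\<close> and \<^term>\<open>order (G Mod center G)\<close> are multiplicative in direct products
  (\<open>card_Cent_DirProd\<close>, \<open>order_Mod_center_DirProd\<close>), and it suffices to see that both numbers are
  $4$ for \<^term>\<open>D8\<close>. For that group they agree because whether two elements commute is decided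
  by a nondegenerate alternating form on the quotient by the center, which is a plane over the
  field with two elements (\<open>centralizer_D8\<close>): by nondegeneracy, distinct classes modulo the
  center have distinct centralizers.

  The F-group property, in contrast, is destroyed by taking products (\<open>not_F_group_DirProd\<close>): if
  \<open>x \<in> G\<close> and \<open>y \<in> H\<close> are noncentral, then so are \<open>(x, y)\<close> and \<open>(x, \<one>)\<close>, but the centralizer
  \<open>C(x) \<times> C(y)\<close> of the first is strictly contained in the centralizer \<open>C(x) \<times> H\<close> of the second.
\<close>

section \<open>Centralizers and centers\<close>

lemma (in group) subgroup_center: "subgroup (center G) G"
proof (rule subgroupI)
  show "center G \<noteq> {}"
    by (auto simp: center_def intro!: exI[of _ \<one>])
next
  fix z assume "z \<in> center G"
  then have z: "z \<in> carrier G" and comm: "\<And>g. g \<in> carrier G \<Longrightarrow> g \<otimes> z = z \<otimes> g"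
    by (auto simp: center_def)
  have "g \<otimes> inv z = inv z \<otimes> g" if g: "g \<in> carrier G" for g
  proof -
    have "z \<otimes> inv g = inv g \<otimes> z"
      using comm[of "inv g"] g by simp
    then have "inv (z \<otimes> inv g) = inv (inv g \<otimes> z)"
      by simp
    then show ?thesis
      using z g by (simp add: inv_mult_group)
  qed
  then show "inv z \<in> center G"
    using z by (auto simp: center_def)
next
  fix y z assume "y \<in> center G" "z \<in> center G"
  then have [simp]: "y \<in> carrier G" "z \<in> carrier G"
    and comm: "\<And>g. g \<in> carrier G \<Longrightarrow> g \<otimes> y = y \<otimes> g" "\<And>g. g \<in> carrier G \<Longrightarrow> g \<otimes> z = z \<otimes> g"
    by (auto simp: center_def)
  have "g \<otimes> (y \<otimes> z) = y \<otimes> z \<otimes> g" if [simp]: "g \<in> carrier G" for g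
  proof -
    have "g \<otimes> (y \<otimes> z) = y \<otimes> (g \<otimes> z)"
      by (simp add: comm(1) flip: m_assoc)
    also have "\<dots> = y \<otimes> z \<otimes> g"
      using comm(2)[of g] by (simp add: m_assoc)
    finally show ?thesis .
  qed
  then show "y \<otimes> z \<in> center G"
    by (simp add: center_def)
qed (auto simp: center_def)

lemma (in group) order_Mod_center: "order (G Mod center G) * card (center G) = order G"
  using lagrange[OF subgroup_center] by (simp add: order_def FactGroup_def)

lemma (in group) one_in_center: "\<one> \<in> center G"
  using subgroup_center by (rule subgroup.one_closed)

lemma (in group) in_centralizer_self: "x \<in> carrier G \<Longrightarrow> x \<in> centralizer G x"
  by (simp add: centralizer_def)

lemma centralizer_eq_carrier_iff:
  assumes "x \<in> carrier G"
  shows "centralizer G x = carrier G \<longleftrightarrow> x \<in> center G"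
  using assms by (auto simp: centralizer_def center_def)

section \<open>Direct products\<close>

lemma centralizer_DirProd:
  "centralizer (G \<times>\<times> H) (x, y) = centralizer G x \<times> centralizer H y"
  by (auto simp: centralizer_def)

lemma center_DirProd:
  assumes "group G" "group H"
  shows "center (G \<times>\<times> H) = center G \<times> center H"
  using group.is_monoid[OF assms(1), THEN monoid.one_closed]
    group.is_monoid[OF assms(2), THEN monoid.one_closed]
  by (auto simp: center_def)

text \<open>A product of two nonempty sets determines both factors, and centralizers are nonempty.\<close>

lemma card_Cent_DirProd:
  assumes "group G" "group H"
  shows "card (Cent (G \<times>\<times> H)) = card (Cent G) * card (Cent H)"
proof -
  have "Cent (G \<times>\<times> H) = (\<lambda>(A, B). A \<times> B) ` (Cent G \<times> Cent H)"
    by (force simp: Cent_def centralizer_DirProd)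
  moreover have "A \<noteq> {}" if "A \<in> Cent G" for A
    using that group.in_centralizer_self[OF assms(1)] by (auto simp: Cent_def)
  moreover have "B \<noteq> {}" if "B \<in> Cent H" for B
    using that group.in_centralizer_self[OF assms(2)] by (auto simp: Cent_def)
  ultimately show ?thesis
    by (auto simp: card_image inj_on_def times_eq_iff card_cartesian_product)
qed

lemma order_Mod_center_DirProd:
  assumes "group G" "group H" "finite (carrier G)" "finite (carrier H)"
  shows "order ((G \<times>\<times> H) Mod center (G \<times>\<times> H)) =
    order (G Mod center G) * order (H Mod center H)"
proof -
  have "finite (center G)" "finite (center H)"
    using assms(3,4) by (simp_all add: center_def)
  then have pos: "card (center G) * card (center H) > 0"
    using group.one_in_center[OF assms(1)] group.one_in_center[OF assms(2)]
    by (auto simp: card_gt_0_iff)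
  have "order ((G \<times>\<times> H) Mod center (G \<times>\<times> H)) * (card (center G) * card (center H)) =
      order (G \<times>\<times> H)"
    using group.order_Mod_center[OF DirProd_group[OF assms(1,2)]]
    by (simp add: center_DirProd assms(1,2) card_cartesian_product)
  also have "\<dots> = order G * order H"
    by (simp add: order_def card_cartesian_product)
  also have "\<dots> = (order (G Mod center G) * order (H Mod center H)) *
      (card (center G) * card (center H))"
    by (simp add: mult_ac flip: group.order_Mod_center[OF assms(1)] group.order_Mod_center[OF assms(2)])
  finally show ?thesis
    using pos by simp
qed

lemma not_F_group_DirProd:
  assumes "group G" "group H"
    and x: "x \<in> carrier G - center G" and y: "y \<in> carrier H - center H"
  shows "\<not> F_group (G \<times>\<times> H)"
proof
  interpret G: group G by fact
  interpret H: group H by fact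
  have one: "centralizer H \<one>\<^bsub>H\<^esub> = carrier H"
    by (simp add: centralizer_eq_carrier_iff H.one_in_center)
  assume "F_group (G \<times>\<times> H)"
  moreover have "(x, y) \<in> carrier (G \<times>\<times> H) - center (G \<times>\<times> H)"
    and "(x, \<one>\<^bsub>H\<^esub>) \<in> carrier (G \<times>\<times> H) - center (G \<times>\<times> H)"
    using x y by (auto simp: center_DirProd assms(1,2))
  moreover have "centralizer (G \<times>\<times> H) (x, y) \<subseteq> centralizer (G \<times>\<times> H) (x, \<one>\<^bsub>H\<^esub>)"
    unfolding centralizer_DirProd one by (auto simp: centralizer_def)
  ultimately have "centralizer (G \<times>\<times> H) (x, y) = centralizer (G \<times>\<times> H) (x, \<one>\<^bsub>H\<^esub>)"
    unfolding F_group_def by blast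
  then have "centralizer H y = carrier H"
    using G.in_centralizer_self[of x] x by (auto simp: centralizer_DirProd one times_eq_iff)
  then show False
    using y by (simp add: centralizer_eq_carrier_iff)
qed

section \<open>The dihedral group of order 8\<close>

text \<open>The class of \<open>(i, b)\<close> modulo the center is given by the parity of \<open>i\<close> and by \<open>b\<close>, and the
  equation on the right is the vanishing of the determinant of the two classes: the rotation
  indices of the two products differ by $2i$ if only \<open>c\<close> holds, by $2j$ if only \<open>b\<close> holds, and by
  $2(i - j)$ if both hold, and this difference matters modulo $4$.\<close>

lemma centralizer_D8:
  assumes "(i, b) \<in> carrier D8"
  shows "centralizer D8 (i, b) = {(j, c) \<in> carrier D8. (odd i \<and> c) = (odd j \<and> b)}"
proof -
  have "(j, c) \<otimes>\<^bsub>D8\<^esub> (i, b) = (i, b) \<otimes>\<^bsub>D8\<^esub> (j, c) \<longleftrightarrow> (odd i \<and> c) = (odd j \<and> b)" for j c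
    by (cases b; cases c) (simp add: dihedral_group_def, presburger?)+
  then show ?thesis
    by (auto simp: centralizer_def)
qed

lemma card_Cent_D8: "card (Cent D8) = 4"
proof -
  \<comment> \<open>the centralizer of an element with rotation index of parity \<open>p\<close>\<close>
  define C where "C = (\<lambda>(p, b). {(j, c) \<in> carrier D8. (p \<and> c) = (odd j \<and> b)})"
  have "Cent D8 = range C"
  proof
    have "centralizer D8 (i, b) = C (odd i, b)" if "(i, b) \<in> carrier D8" for i b
      using that by (simp add: centralizer_D8 C_def)
    then show "Cent D8 \<subseteq> range C"
      unfolding Cent_def by fast
    show "range C \<subseteq> Cent D8"
    proof (rule image_subsetI)
      fix u :: "bool \<times> bool"
      have rep: "(if fst u then 1 else 0, snd u) \<in> carrier D8"
        by (simp add: dihedral_group_def)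
      then have "C u = centralizer D8 (if fst u then 1 else 0, snd u)"
        by (simp add: centralizer_D8 C_def case_prod_beta)
      with rep show "C u \<in> Cent D8"
        unfolding Cent_def by blast
    qed
  qed
  moreover have "inj C"
  proof (rule injI)
    fix u v assume eq: "C u = C v"
    \<comment> \<open>Nondegeneracy: testing against a reflection and a rotation recovers both coordinates.\<close>
    have "(0, True) \<in> C w \<longleftrightarrow> \<not> fst w" "(1, False) \<in> C w \<longleftrightarrow> \<not> snd w" for w
      by (auto simp: C_def dihedral_group_def split: prod.splits)
    then show "u = v"
      using eq by (metis prod.expand)
  qed
  ultimately show ?thesis
    by (simp add: card_image card_cartesian_product flip: UNIV_Times_UNIV)
qed

lemma center_D8: "center D8 = {(0, False), (2, False)}"
proof -
  have central: "(i, b) \<in> center D8 \<longleftrightarrow> even i \<and> \<not> b" if ib: "(i, b) \<in> carrier D8" for i b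
  proof
    assume "(i, b) \<in> center D8"
    then have *: "{(j, c) \<in> carrier D8. (odd i \<and> c) = (odd j \<and> b)} = carrier D8"
      using centralizer_eq_carrier_iff[OF ib] centralizer_D8[OF ib] by simp
    have "(0, True) \<in> carrier D8" "(1, False) \<in> carrier D8"
      by (simp_all add: dihedral_group_def)
    then have "(0, True) \<in> {(j, c) \<in> carrier D8. (odd i \<and> c) = (odd j \<and> b)}"
      and "(1, False) \<in> {(j, c) \<in> carrier D8. (odd i \<and> c) = (odd j \<and> b)}"
      unfolding * .
    then show "even i \<and> \<not> b"
      by simp
  next
    assume "even i \<and> \<not> b"
    then have "centralizer D8 (i, b) = carrier D8"
      using centralizer_D8[OF ib] by simp
    then show "(i, b) \<in> center D8"
      using centralizer_eq_carrier_iff[OF ib] by simp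
  qed
  have carrier: "(i, b) \<in> carrier D8 \<longleftrightarrow> 0 \<le> i \<and> i < 4" for i b
    by (simp add: dihedral_group_def)
  have even: "0 \<le> i \<and> i < 4 \<and> even i \<longleftrightarrow> i = 0 \<or> i = 2" for i :: int
    by presburger
  have "(i, b) \<in> center D8 \<longleftrightarrow> (i, b) \<in> {(0, False), (2, False)}" for i b
  proof (cases "(i, b) \<in> carrier D8")
    case True
    then show ?thesis
      using even[of i] unfolding central[OF True] carrier by simp blast
  next
    case False
    then have "(i, b) \<notin> center D8"
      by (simp add: center_def)
    then show ?thesis
      using False unfolding carrier by auto
  qed
  then have "x \<in> center D8 \<longleftrightarrow> x \<in> {(0, False), (2, False)}" for x
    by (cases x) (simp only:)
  then show ?thesis
    by (rule Set.set_eqI)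
qed

lemma order_Mod_center_D8: "order (D8 Mod center D8) = 4"
  using group.order_Mod_center[OF group_dihedral_group, of 4]
  by (simp add: order_dihedral_group center_D8)

theorem mainTheorem4:
  shows "group (D8 \<times>\<times> D8) \<and> finite (carrier (D8 \<times>\<times> D8)) \<and>
    card (Cent (D8 \<times>\<times> D8)) = order ((D8 \<times>\<times> D8) Mod center (D8 \<times>\<times> D8)) \<and>
    order ((D8 \<times>\<times> D8) Mod center (D8 \<times>\<times> D8)) = 16 \<and>
    \<not> F_group (D8 \<times>\<times> D8) \<and>
    \<not> (\<forall>H :: ((int \<times> bool) \<times> (int \<times> bool)) monoid.
         group H \<and> finite (carrier H) \<and> card (Cent H) = order (H Mod center H)
           \<longrightarrow> F_group H)"
proof -
  have D8: "group D8"
    by (simp add: group_dihedral_group)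
  have fin: "finite (carrier D8)"
    by (simp add: dihedral_group_def)
  have 1: "group (D8 \<times>\<times> D8)" "finite (carrier (D8 \<times>\<times> D8))"
    using D8 fin by (simp_all add: DirProd_group)
  have 2: "card (Cent (D8 \<times>\<times> D8)) = 16"
    by (simp add: card_Cent_DirProd D8 card_Cent_D8)
  have 3: "order ((D8 \<times>\<times> D8) Mod center (D8 \<times>\<times> D8)) = 16"
    by (simp add: order_Mod_center_DirProd D8 fin order_Mod_center_D8)
  have "(1, False) \<in> carrier D8 - center D8"
    unfolding center_D8 by (simp add: dihedral_group_def)
  with D8 have 4: "\<not> F_group (D8 \<times>\<times> D8)"
    by (intro not_F_group_DirProd)
  have eq: "card (Cent (D8 \<times>\<times> D8)) = order ((D8 \<times>\<times> D8) Mod center (D8 \<times>\<times> D8))"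
    by (simp only: 2 3)
  have "\<not> (\<forall>H :: ((int \<times> bool) \<times> (int \<times> bool)) monoid.
      group H \<and> finite (carrier H) \<and> card (Cent H) = order (H Mod center H) \<longrightarrow> F_group H)"
  proof
    assume "\<forall>H :: ((int \<times> bool) \<times> (int \<times> bool)) monoid.
      group H \<and> finite (carrier H) \<and> card (Cent H) = order (H Mod center H) \<longrightarrow> F_group H"
    from this[rule_format, of "D8 \<times>\<times> D8"] 1 eq 4 show False
      by blast
  qed
  with 1 eq 3 4 show ?thesis
    by (intro conjI)
qed

end
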